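(* Let $G=(V,E\cup A)$ be a mixed graph and $k\ge1$ an integer such that $E\cup A$ can be partitioned into $k$ mixed edge covers. Then $E\cup A$ can be partitioned into $k$ mixed edge covers $F_1,\dots,F_k$ such that, writing $N_i:=F_i\cap E$ and $B_i:=F_i\cap A$, for every $i,j\in\{1,\dots,k\}$ we have $\big||F_i|-|F_j|\big|\le 1$, $\big||N_i|-|N_j|\big|\le 2$, and $\big||B_i|-|B_j|\big|\le 2$.
   Context: A mixed graph $G=(V,E\cup A)$ has a finite vertex set $V$, a set $E$ of undirected edges and a set $A$ of directed arcs; there are no loops, but parallel edges/arcs are allowed. A mixed edge cover is a subset $F\subseteq E\cup A$ such that for every $v\in V$ there is a directed path (possibly of length $0$) using only arcs of $F\cap A$ from an endpoint of some edge $e\in F\cap E$ to $v$. *)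

theory Defs
  imports "HOL-Library.Disjoint_Sets" "Graph_Theory.Digraph" "Graph_Theory.Arc_Walk"
begin

text \<open>
  The vertices and the directed arcs of a mixed graph form a digraph \<open>D\<close>; \<open>E\<close> is the set of
  undirected edges and \<open>ends e\<close> is the set of the two endpoints of \<open>e\<close>. Edges and arcs are
  identifiers with an incidence function, so both kinds may have parallel members.
\<close>

locale mixed_graph = fin_digraph D + loopfree_digraph D
  for D :: "('v, 'e) pre_digraph" +
  fixes E :: "'e set" and ends :: "'e \<Rightarrow> 'v set"
  assumes finite_edges: "finite E"
    and edges_arcs_disjoint: "E \<inter> arcs D = {}"
    and ends_subset: "e \<in> E \<Longrightarrow> ends e \<subseteq> verts D"
    and card_ends: "e \<in> E \<Longrightarrow> card (ends e) = 2"

definition mixed_edge_cover ::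
    "('v, 'e) pre_digraph \<Rightarrow> 'e set \<Rightarrow> ('e \<Rightarrow> 'v set) \<Rightarrow> 'e set \<Rightarrow> bool" where
  "mixed_edge_cover D E ends F \<longleftrightarrow>
     F \<subseteq> E \<union> arcs D \<and>
     (\<forall>v \<in> verts D. \<exists>e \<in> F \<inter> E. \<exists>u \<in> ends e. \<exists>p.
        pre_digraph.apath (D\<lparr>arcs := F \<inter> arcs D\<rparr>) u p v)"

text \<open>
  The parts are indexed by \<open>{1..k}\<close>. Empty parts are not excluded explicitly: an empty part is a
  mixed edge cover only if there are no vertices.
\<close>

definition mixed_edge_cover_partition ::
    "('v, 'e) pre_digraph \<Rightarrow> 'e set \<Rightarrow> ('e \<Rightarrow> 'v set) \<Rightarrow> nat \<Rightarrow> (nat \<Rightarrow> 'e set) \<Rightarrow> bool" where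
  "mixed_edge_cover_partition D E ends k F \<longleftrightarrow>
     (\<Union>i\<in>{1..k}. F i) = E \<union> arcs D \<and>
     disjoint_family_on F {1..k} \<and>
     (\<forall>i\<in>{1..k}. mixed_edge_cover D E ends (F i))"

end

theory Submission
  imports Defs
begin

text \<open>
  Two parts suffice: a partition minimising the sum of
  \<open>4 * |F\<^sub>i|\<^sup>2 + |N\<^sub>i|\<^sup>2 + |B\<^sub>i|\<^sup>2\<close> is balanced as soon as any two covers can be
  redistributed into a balanced pair.

  For two covers, let \<open>R\<^sub>i\<close> be the set of vertices met by \<open>N\<^sub>i\<close> and pick a branching
  \<open>T\<^sub>i \<subseteq> B\<^sub>i\<close> with root set \<open>R\<^sub>i\<close>. By Edmonds' theorem \<open>T\<^sub>1 \<union> T\<^sub>2\<close> splits into branchings with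
  new root sets whenever these have the same union and intersection as \<open>R\<^sub>1, R\<^sub>2\<close> and both meet
  every source component of \<open>T\<^sub>1 \<union> T\<^sub>2\<close>. Choosing an edge for each root, these requirements say
  that certain pairs of edges, one from \<open>N\<^sub>1\<close> and one from \<open>N\<^sub>2\<close>, stay on different sides. The
  graph of these links is bipartite of maximum degree two, so its components are paths and
  even cycles. They can be swapped independently: each contributes \<open>v\<close> or \<open>-v\<close> to the vector
  \<open>(|N\<^sub>1| - |N\<^sub>2|, |F\<^sub>1| - |F\<^sub>2|)\<close>, for some \<open>v\<close> with coordinates in \<open>{-1, 0, 1}\<close>, and an arc
  outside \<open>T\<^sub>1 \<union> T\<^sub>2\<close>, which can be placed freely, contributes \<open>(0, 1)\<close> or \<open>(0, -1)\<close>. It remains to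
  choose signs that keep the sum small.
\<close>

section \<open>Spanning branchings\<close>

text \<open>Every vertex of \<open>V\<close> is reachable from \<open>R\<close> by arcs of \<open>T\<close>, expressed through cuts.\<close>

definition spans :: "('e \<Rightarrow> 'v) \<Rightarrow> ('e \<Rightarrow> 'v) \<Rightarrow> 'v set \<Rightarrow> 'v set \<Rightarrow> 'e set \<Rightarrow> bool" where
  "spans t h V R T \<longleftrightarrow>
     (\<forall>X\<subseteq>V. X \<noteq> {} \<longrightarrow> X \<inter> R = {} \<longrightarrow> (\<exists>a\<in>T. h a \<in> X \<and> t a \<notin> X))"

lemma spansD:
  assumes "spans t h V R T" "X \<subseteq> V" "X \<noteq> {}" "X \<inter> R = {}"
  obtains a where "a \<in> T" "h a \<in> X" "t a \<notin> X"
  using assms unfolding spans_def by blast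

lemma spans_mono:
  assumes "spans t h V R T" "R \<subseteq> R'" "T \<subseteq> T'"
  shows "spans t h V R' T'"
  unfolding spans_def
proof (intro allI impI)
  fix X assume X: "X \<subseteq> V" "X \<noteq> {}" "X \<inter> R' = {}"
  with assms(2) have "X \<inter> R = {}" by blast
  from spansD[OF assms(1) X(1,2) this] assms(3)
  show "\<exists>a\<in>T'. h a \<in> X \<and> t a \<notin> X" by blast
qed

text \<open>A set that avoids \<open>R\<close> but contains \<open>h a\<close> is entered by
  \<open>a\<close> itself, because \<open>t a\<close> lies in \<open>R\<close>; any other set
  avoiding \<open>R\<close> also avoids the enlarged root set. This is how branchings grow arc by
  arc.\<close>

lemma spans_insert:
  assumes "spans t h V (insert (h a) R) T" "t a \<in> R"
  shows "spans t h V R (insert a T)"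
  unfolding spans_def
proof (intro allI impI)
  fix X assume X: "X \<subseteq> V" "X \<noteq> {}" "X \<inter> R = {}"
  show "\<exists>b\<in>insert a T. h b \<in> X \<and> t b \<notin> X"
  proof (cases "h a \<in> X")
    case True
    with X assms(2) show ?thesis by blast
  next
    case False
    with X assms(1) show ?thesis unfolding spans_def by auto
  qed
qed

text \<open>Some arc \<open>a\<close> enters \<open>V - R\<close>. Once \<open>h a\<close> counts as
  a root, \<open>a\<close> enters no set that avoids the roots, so it can be set aside and the
  induction continues with one vertex less. The exact size later makes arc counts computable from
  root counts.\<close>

lemma spans_minimal:
  assumes "finite V" "finite B" "t ` B \<subseteq> V" "spans t h V R B"
  shows "\<exists>T\<subseteq>B. spans t h V R T \<and> card T = card (V - R)"
  using assms(2-)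
proof (induction "card (V - R)" arbitrary: R B)
  case 0
  then have "V \<subseteq> R" using assms(1) by auto
  then have "spans t h V R {}" unfolding spans_def by blast
  with 0 show ?case by (metis card.empty empty_subsetI)
next
  case (Suc n)
  have "V - R \<noteq> {}" using Suc.hyps(2) by force
  then obtain a where a: "a \<in> B" "h a \<in> V - R" "t a \<notin> V - R"
    using spansD[OF Suc.prems(3), of "V - R"] by blast
  have "V - insert (h a) R = (V - R) - {h a}" by blast
  then have n: "n = card (V - insert (h a) R)"
    using Suc.hyps(2) a(2) assms(1) by (simp add: card_Diff_singleton)
  have "spans t h V (insert (h a) R) (B - {a})"
    unfolding spans_def
  proof (intro allI impI)
    fix X assume X: "X \<subseteq> V" "X \<noteq> {}" "X \<inter> insert (h a) R = {}"
    then obtain b where "b \<in> B" "h b \<in> X" "t b \<notin> X"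
      using spansD[OF Suc.prems(3), of X] by auto
    with X show "\<exists>b\<in>B - {a}. h b \<in> X \<and> t b \<notin> X" by auto
  qed
  with Suc.hyps(1)[OF n, of "B - {a}"] Suc.prems obtain T where T: "T \<subseteq> B - {a}"
    "spans t h V (insert (h a) R) T" "card T = n"
    using n by auto
  have ta: "t a \<in> R" using a Suc.prems(2) by auto
  have "finite T" "a \<notin> T" using T(1) Suc.prems(1) finite_subset by blast+
  then have "card (insert a T) = card (V - R)" using T(3) Suc.hyps(2) by simp
  moreover have "insert a T \<subseteq> B" using a T by blast
  ultimately show ?case using spans_insert[OF T(2) ta] by blast
qed

lemma spans_card_ge:
  assumes "finite V" "finite T" "t ` T \<subseteq> V" "spans t h V R T"
  shows "card (V - R) \<le> card T"
  using spans_minimal[OF assms] assms(2) card_mono by metis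

section \<open>In-degrees and Edmonds' theorem for two branchings\<close>

definition indeg :: "('e \<Rightarrow> 'v) \<Rightarrow> ('e \<Rightarrow> 'v) \<Rightarrow> 'e set \<Rightarrow> 'v set \<Rightarrow> nat" where
  "indeg t h T X = card {a\<in>T. h a \<in> X \<and> t a \<notin> X}"

text \<open>An arc entering the intersection or the union enters \<open>X\<close> or
  \<open>Y\<close>, and an arc entering both of them enters both \<open>X\<close> and
  \<open>Y\<close>.\<close>

lemma indeg_submodular:
  assumes "finite T"
  shows "indeg t h T (X \<inter> Y) + indeg t h T (X \<union> Y) \<le> indeg t h T X + indeg t h T Y"
proof -
  let ?i = "\<lambda>Z. {a\<in>T. h a \<in> Z \<and> t a \<notin> Z}"
  have f: "finite (?i Z)" for Z using assms by simp
  have "card (?i (X \<inter> Y)) + card (?i (X \<union> Y))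
      = card (?i (X \<inter> Y) \<union> ?i (X \<union> Y)) + card (?i (X \<inter> Y) \<inter> ?i (X \<union> Y))"
    using card_Un_Int[OF f f] .
  also have "\<dots> \<le> card (?i X \<union> ?i Y) + card (?i X \<inter> ?i Y)"
    by (intro add_mono card_mono) (use f in auto)
  also have "\<dots> = card (?i X) + card (?i Y)"
    using card_Un_Int[OF f f] by simp
  finally show ?thesis unfolding indeg_def .
qed

lemma indeg_remove:
  assumes "finite T" "a \<in> T"
  shows "indeg t h T X = indeg t h (T - {a}) X + (if h a \<in> X \<and> t a \<notin> X then 1 else 0)"
proof (cases "h a \<in> X \<and> t a \<notin> X")
  case True
  then have "{b\<in>T. h b \<in> X \<and> t b \<notin> X} = insert a {b\<in>T - {a}. h b \<in> X \<and> t b \<notin> X}"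
    using assms(2) by auto
  then show ?thesis using True assms(1) unfolding indeg_def by (simp add: card_insert_if)
next
  case False
  then have "{b\<in>T. h b \<in> X \<and> t b \<notin> X} = {b\<in>T - {a}. h b \<in> X \<and> t b \<notin> X}" by auto
  then show ?thesis using False unfolding indeg_def by auto
qed

lemma indeg_pos:
  assumes "indeg t h T X \<noteq> 0"
  shows "\<exists>a\<in>T. h a \<in> X \<and> t a \<notin> X"
proof -
  have "{a\<in>T. h a \<in> X \<and> t a \<notin> X} \<noteq> {}"
    using assms unfolding indeg_def by (metis card.empty)
  then show ?thesis by blast
qed

text \<open>The cut condition of Edmonds' theorem for two arc-disjoint branchings with root sets
  \<open>R\<close> and \<open>S\<close>.\<close>

definition splittable ::
    "('e \<Rightarrow> 'v) \<Rightarrow> ('e \<Rightarrow> 'v) \<Rightarrow> 'v set \<Rightarrow> 'v set \<Rightarrow> 'v set \<Rightarrow> 'e set \<Rightarrow> bool" where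
  "splittable t h V R S T \<longleftrightarrow> (\<forall>X\<subseteq>V. X \<noteq> {} \<longrightarrow>
     indeg t h T X \<ge> (if X \<inter> R = {} then 1 else 0) + (if X \<inter> S = {} then 1 else 0))"

lemma splittableD:
  assumes "splittable t h V R S T" "X \<subseteq> V" "X \<noteq> {}"
  shows "indeg t h T X \<ge> (if X \<inter> R = {} then 1 else 0) + (if X \<inter> S = {} then 1 else 0)"
  using assms unfolding splittable_def by blast

text \<open>
  Lovasz's proof: grow the first branching by one arc, which must not enter a critical set. An
  arc that leaves \<open>R\<close> inside an inclusion-minimal critical set qualifies, by submodularity.
\<close>

lemma edmonds_two_branchings:
  assumes "finite V" "finite T" "t ` T \<subseteq> V" "splittable t h V R S T"
  shows "\<exists>P Q. P \<inter> Q = {} \<and> P \<union> Q = T \<and> spans t h V R P \<and> spans t h V S Q"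
  using assms(2-)
proof (induction "card (V - R)" arbitrary: R T)
  case 0
  then have "V \<subseteq> R" using assms(1) by auto
  then have "spans t h V R {}" unfolding spans_def by blast
  moreover have "spans t h V S T"
    unfolding spans_def
  proof (intro allI impI)
    fix X assume X: "X \<subseteq> V" "X \<noteq> {}" "X \<inter> S = {}"
    then have "indeg t h T X \<noteq> 0"
      using splittableD[OF 0(4) X(1,2)] by simp
    then show "\<exists>a\<in>T. h a \<in> X \<and> t a \<notin> X" by (rule indeg_pos)
  qed
  ultimately show ?case by blast
next
  case (Suc n)
  note ft = Suc.prems(1) and tV = Suc.prems(2)
  have cond: "indeg t h T X \<ge> (if X \<inter> R = {} then 1 else 0) + (if X \<inter> S = {} then 1 else 0)"
    if "X \<subseteq> V" "X \<noteq> {}" for X using splittableD[OF Suc.prems(3) that] .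
  \<comment> \<open>The only arc entering a critical set must be kept for the branching rooted at
    \<open>S\<close>; spending it on the first branching would violate the cut condition.\<close>
  define crit where "crit X \<longleftrightarrow> X \<subseteq> V \<and> X \<inter> R \<noteq> {} \<and> X - R \<noteq> {} \<and> X \<inter> S = {} \<and> indeg t h T X = 1" for X
  have "\<exists>a\<in>T. t a \<in> R \<and> h a \<in> V - R \<and> (\<forall>X. crit X \<longrightarrow> \<not> (h a \<in> X \<and> t a \<notin> X))"
  proof (cases "\<exists>X. crit X")
    case False
    have ne: "V - R \<noteq> {}" using Suc.hyps(2) by force
    then have "indeg t h T (V - R) \<noteq> 0" using cond[OF _ ne] by (simp add: Diff_Int_distrib2)
    then obtain a where "a \<in> T" "h a \<in> V - R" "t a \<notin> V - R" using indeg_pos by blast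
    with False tV show ?thesis by blast
  next
    case True
    define X where "X = (ARG_MIN card X. crit X)"
    have cX: "crit X" and mX: "\<And>Y. crit Y \<Longrightarrow> card X \<le> card Y"
      unfolding X_def using True arg_min_natI arg_min_nat_le by metis+
    \<comment> \<open>\<open>X - R\<close> misses both root sets, so at least two arcs enter it,
      while only one enters \<open>X\<close>. Hence some arc runs from \<open>X \<inter> R\<close>
      into \<open>X - R\<close>.\<close>
    have "indeg t h T (X - R) \<ge> 2"
    proof -
      have "X - R \<subseteq> V" "X - R \<noteq> {}" "(X - R) \<inter> R = {}" "(X - R) \<inter> S = {}"
        using cX unfolding crit_def by blast+
      with cond[of "X - R"] show ?thesis by simp
    qed
    then have gt: "indeg t h T (X - R) > indeg t h T X" using cX unfolding crit_def by simp
    have "\<not> {a\<in>T. h a \<in> X - R \<and> t a \<notin> X - R} \<subseteq> {a\<in>T. h a \<in> X \<and> t a \<notin> X}"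
    proof
      assume "{a\<in>T. h a \<in> X - R \<and> t a \<notin> X - R} \<subseteq> {a\<in>T. h a \<in> X \<and> t a \<notin> X}"
      from card_mono[OF _ this] gt ft show False unfolding indeg_def by simp
    qed
    then obtain a where a: "a \<in> T" "h a \<in> X - R" "t a \<in> X" "t a \<in> R" by auto
    have "\<not> (h a \<in> Y \<and> t a \<notin> Y)" if Y: "crit Y" for Y
    proof
      assume e: "h a \<in> Y \<and> t a \<notin> Y"
      have I: "X \<inter> Y \<subseteq> V" "X \<inter> Y \<noteq> {}" "(X \<inter> Y) \<inter> S = {}" "X \<inter> Y - R \<noteq> {}"
        using cX Y e a unfolding crit_def by blast+
      have U: "X \<union> Y \<subseteq> V" "X \<union> Y \<noteq> {}" "(X \<union> Y) \<inter> S = {}"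
        using cX Y e a unfolding crit_def by blast+
      \<comment> \<open>The in-degrees of two critical sets add up to 2 and the union needs at least
        1, so the intersection has in-degree exactly 1 and cannot miss \<open>R\<close>. It is then
        critical and, lacking \<open>t a\<close>, smaller than \<open>X\<close>.\<close>
      have "indeg t h T (X \<inter> Y) + indeg t h T (X \<union> Y) \<le> 2"
        using indeg_submodular[OF ft, of t h X Y] cX Y unfolding crit_def by simp
      moreover have "indeg t h T (X \<union> Y) \<ge> 1" using cond[OF U(1,2)] U(3) by simp
      moreover have "indeg t h T (X \<inter> Y) \<ge> 1 + (if X \<inter> Y \<inter> R = {} then 1 else 0)"
        using cond[OF I(1,2)] I(3) by simp
      ultimately have "indeg t h T (X \<inter> Y) = 1" "X \<inter> Y \<inter> R \<noteq> {}" by (auto split: if_splits)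
      then have "crit (X \<inter> Y)" unfolding crit_def using I by blast
      moreover have "finite X" using cX assms(1) finite_subset unfolding crit_def by blast
      moreover have "X \<inter> Y \<subset> X" using a e by blast
      ultimately show False using mX psubset_card_mono by (metis leD)
    qed
    moreover have "h a \<in> V - R" using a cX unfolding crit_def by blast
    ultimately show ?thesis using a by blast
  qed
  then obtain a where a: "a \<in> T" "t a \<in> R" "h a \<in> V - R"
    "\<And>X. crit X \<Longrightarrow> \<not> (h a \<in> X \<and> t a \<notin> X)" by blast
  have "V - insert (h a) R = (V - R) - {h a}" by blast
  then have n: "n = card (V - insert (h a) R)"
    using Suc.hyps(2) a(3) assms(1) by (simp add: card_Diff_singleton)
  have "splittable t h V (insert (h a) R) S (T - {a})"
    unfolding splittable_def
  proof (intro allI impI)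
    fix X assume X: "X \<subseteq> V" "X \<noteq> {}"
    note c = cond[OF X] indeg_remove[OF ft a(1), of t h X]
    show "(if X \<inter> insert (h a) R = {} then 1 else 0) + (if X \<inter> S = {} then 1 else 0)
      \<le> indeg t h (T - {a}) X"
    proof (cases "h a \<in> X \<and> t a \<notin> X")
      case False
      then show ?thesis using c by (auto split: if_splits)
    next
      case True
      show ?thesis
      proof (cases "X \<inter> R = {}")
        case True
        then show ?thesis using c \<open>h a \<in> X \<and> t a \<notin> X\<close> by (auto split: if_splits)
      next
        case False
        \<comment> \<open>As \<open>h a\<close> lies in \<open>X - R\<close>, not being critical
          means that \<open>X\<close> meets \<open>S\<close> or has a second entering arc.\<close>
        have "\<not> crit X" using a(4) True by blast
        then have "X \<inter> S = {} \<Longrightarrow> indeg t h T X \<noteq> 1"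
          using X False True a(3) unfolding crit_def by blast
        then show ?thesis using c True by (auto split: if_splits)
      qed
    qed
  qed
  then obtain P Q where PQ: "P \<inter> Q = {}" "P \<union> Q = T - {a}"
      "spans t h V (insert (h a) R) P" "spans t h V S Q"
    using Suc.hyps(1)[OF n, of "T - {a}"] ft tV by auto
  have "insert a P \<inter> Q = {}" "insert a P \<union> Q = T" using PQ(1,2) a(1) by blast+
  with spans_insert[OF PQ(3) a(2)] PQ(4) show ?case by blast
qed

section \<open>Links between roots\<close>

text \<open>
  The classes of \<open>\<kappa>\<close> are the components of the graph with an edge from \<open>a l\<close> to \<open>c l\<close> for every
  link \<open>l\<close>; a component has at most one node more than it has edges.
\<close>

lemma link_classes:
  assumes "finite L" "finite N" "\<And>l. l \<in> L \<Longrightarrow> a l \<in> N"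
  shows "\<exists>\<kappa>. (\<forall>e\<in>N. \<kappa> e \<in> N) \<and> (\<forall>l\<in>L. \<kappa> (a l) = \<kappa> (c l)) \<and>
    (\<forall>i. card {e\<in>N. \<kappa> e = i} \<le> card {l\<in>L. \<kappa> (a l) = i} + 1)"
  using assms(1,3)
proof (induction L rule: finite_induct)
  case empty
  have "{e\<in>N. e = i} \<subseteq> {i}" for i by blast
  then have "card {e\<in>N. e = i} \<le> 1" for i
    by (metis card_mono finite.emptyI finite.insertI is_singletonI is_singleton_altdef)
  then show ?case by (intro exI[of _ "\<lambda>e. e"]) auto
next
  case (insert m L)
  then obtain \<kappa> where k: "\<forall>e\<in>N. \<kappa> e \<in> N" "\<And>l. l \<in> L \<Longrightarrow> \<kappa> (a l) = \<kappa> (c l)"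
    "\<And>i. card {e\<in>N. \<kappa> e = i} \<le> card {l\<in>L. \<kappa> (a l) = i} + 1" by auto
  have fin: "finite {l \<in> insert m L. P l}" "finite {l \<in> L. P l}" for P using insert(1) by auto
  show ?case
  proof (cases "\<kappa> (a m) = \<kappa> (c m)")
    case True
    have "card {l\<in>L. \<kappa> (a l) = i} \<le> card {l\<in>insert m L. \<kappa> (a l) = i}" for i
      by (intro card_mono fin) auto
    then have "card {e\<in>N. \<kappa> e = i} \<le> card {l\<in>insert m L. \<kappa> (a l) = i} + 1" for i
      using k(3)[of i] le_trans add_le_mono1 by blast
    with True k(1,2) show ?thesis by (intro exI[of _ \<kappa>]) auto
  next
    case False
    \<comment> \<open>Class \<open>q\<close> is merged into \<open>p\<close>. Each of the two bounds
      has one spare unit; the merged class keeps one of them and the new link \<open>m\<close> pays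
      for the other.\<close>
    define p q where "p = \<kappa> (a m)" and "q = \<kappa> (c m)"
    define \<kappa>' where "\<kappa>' e = (if \<kappa> e = q then p else \<kappa> e)" for e
    have pN: "p \<in> N" using k(1) insert(4) p_def by auto
    have pq: "p \<noteq> q" using False p_def q_def by simp
    have "card {e\<in>N. \<kappa>' e = i} \<le> card {l\<in>insert m L. \<kappa>' (a l) = i} + 1" for i
    proof -
      consider "i = p" | "i = q" | "i \<noteq> p" "i \<noteq> q" by blast
      then show ?thesis
      proof cases
        case 1
        have "{e\<in>N. \<kappa>' e = p} = {e\<in>N. \<kappa> e = p} \<union> {e\<in>N. \<kappa> e = q}"
          unfolding \<kappa>'_def by auto
        then have "card {e\<in>N. \<kappa>' e = p} \<le> card {e\<in>N. \<kappa> e = p} + card {e\<in>N. \<kappa> e = q}"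
          by (simp only: card_Un_le)
        moreover have "{l\<in>insert m L. \<kappa>' (a l) = p}
          = insert m ({l\<in>L. \<kappa> (a l) = p} \<union> {l\<in>L. \<kappa> (a l) = q})"
          unfolding \<kappa>'_def p_def by auto
        moreover have "card \<dots> = Suc (card {l\<in>L. \<kappa> (a l) = p} + card {l\<in>L. \<kappa> (a l) = q})"
        proof -
          have "card ({l\<in>L. \<kappa> (a l) = p} \<union> {l\<in>L. \<kappa> (a l) = q})
              = card {l\<in>L. \<kappa> (a l) = p} + card {l\<in>L. \<kappa> (a l) = q}"
            by (rule card_Un_disjoint) (use fin pq in auto)
          then show ?thesis using insert(2) fin by (subst card_insert_disjoint) auto
        qed
        ultimately show ?thesis using k(3)[of p] k(3)[of q] 1 by simp
      next
        case 2
        then have "{e\<in>N. \<kappa>' e = i} = {}" using pq unfolding \<kappa>'_def by auto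
        then show ?thesis by (metis card.empty le0)
      next
        case 3
        then have "{e\<in>N. \<kappa>' e = i} = {e\<in>N. \<kappa> e = i}" unfolding \<kappa>'_def by auto
        moreover have "card {l\<in>L. \<kappa> (a l) = i} \<le> card {l\<in>insert m L. \<kappa>' (a l) = i}"
          by (intro card_mono fin) (use 3 in \<open>auto simp: \<kappa>'_def\<close>)
        ultimately show ?thesis using k(3)[of i] by simp
      qed
    qed
    moreover have "\<forall>e\<in>N. \<kappa>' e \<in> N" using k(1) pN unfolding \<kappa>'_def by auto
    moreover have "\<forall>l\<in>insert m L. \<kappa>' (a l) = \<kappa>' (c l)"
      using k(2) unfolding \<kappa>'_def p_def q_def by auto
    ultimately show ?thesis by blast
  qed
qed

text \<open>
  The minimal members of \<open>\<C>\<close> are disjoint; in the application they are the source components,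
  and each of them contributes one link.
\<close>

lemma links_exist:
  assumes "finite V" and C: "\<And>X. X \<in> \<C> \<Longrightarrow> X \<subseteq> V"
    and int: "\<And>X Y. X \<in> \<C> \<Longrightarrow> Y \<in> \<C> \<Longrightarrow> X \<inter> Y \<noteq> {} \<Longrightarrow> X \<inter> Y \<in> \<C>"
    and meet: "\<And>X. X \<in> \<C> \<Longrightarrow> X \<inter> R \<noteq> {}" "\<And>X. X \<in> \<C> \<Longrightarrow> X \<inter> S \<noteq> {}"
  shows "\<exists>L\<subseteq>R \<times> S. inj_on fst L \<and> inj_on snd L \<and> (\<forall>v\<in>R \<inter> S. (v, v) \<in> L) \<and>
    (\<forall>X\<in>\<C>. \<exists>u w. (u, w) \<in> L \<and> u \<in> X \<and> w \<in> X)"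
proof -
  define \<K> where "\<K> = {K\<in>\<C>. \<forall>X\<in>\<C>. X \<subseteq> K \<longrightarrow> X = K}"
  \<comment> \<open>A set containing a common vertex of \<open>R\<close> and \<open>S\<close> is
    assigned a link from such a vertex to itself. This is one of the diagonal links required anyway,
    so it gives no vertex a second link.\<close>
  have "\<forall>K\<in>\<C>. \<exists>p. fst p \<in> K \<inter> R \<and> snd p \<in> K \<inter> S \<and> (K \<inter> R \<inter> S \<noteq> {} \<longrightarrow> fst p = snd p)"
  proof
    fix K assume K: "K \<in> \<C>"
    show "\<exists>p. fst p \<in> K \<inter> R \<and> snd p \<in> K \<inter> S \<and> (K \<inter> R \<inter> S \<noteq> {} \<longrightarrow> fst p = snd p)"
    proof (cases "K \<inter> R \<inter> S = {}")
      case True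
      then show ?thesis using meet[OF K] by auto
    next
      case False
      then obtain v where "v \<in> K \<inter> R \<inter> S" by blast
      then show ?thesis by (intro exI[of _ "(v, v)"]) auto
    qed
  qed
  then obtain p where p: "\<And>K. K \<in> \<C> \<Longrightarrow> fst (p K) \<in> K \<inter> R"
      "\<And>K. K \<in> \<C> \<Longrightarrow> snd (p K) \<in> K \<inter> S"
      "\<And>K. K \<in> \<C> \<Longrightarrow> K \<inter> R \<inter> S \<noteq> {} \<Longrightarrow> fst (p K) = snd (p K)" by metis
  have K: "K \<in> \<C>" if "K \<in> \<K>" for K using that \<K>_def by blast
  have minimal: "X = K" if "K \<in> \<K>" "X \<in> \<C>" "X \<subseteq> K" for X K
    using that unfolding \<K>_def by simp
  have disj: "K = K'" if "K \<in> \<K>" "K' \<in> \<K>" "K \<inter> K' \<noteq> {}" for K K'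
  proof -
    have "K \<inter> K' \<in> \<C>" using int K that by blast
    then have "K \<inter> K' = K" "K \<inter> K' = K'" using minimal that by auto
    then show ?thesis by blast
  qed
  have diag: "fst (p K) = snd (p K)" if "K \<in> \<K>" "fst (p K) \<in> S \<or> snd (p K) \<in> R" for K
    using p[OF K[OF that(1)]] that(2) by blast
  define L where "L = Id_on (R \<inter> S) \<union> p ` \<K>"
  have "p K \<in> R \<times> S" if "K \<in> \<K>" for K
    using p(1,2)[OF K[OF that]] by (simp add: mem_Times_iff)
  then have "L \<subseteq> R \<times> S" unfolding L_def by (intro Un_least) (auto simp: image_subset_iff simp del: mem_Sigma_iff)
  moreover have off: "\<exists>K\<in>\<K>. x = p K" if "x \<in> L" "fst x \<notin> S \<or> snd x \<notin> R" for x
    using that unfolding L_def by auto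
  moreover have "inj_on fst L"
  proof (rule inj_onI)
    fix x y assume xy: "x \<in> L" "y \<in> L" "fst x = fst y"
    have equal: "fst x = snd x" if "x \<in> L" "fst x \<in> S" for x
      using that diag unfolding L_def by (auto simp: Id_on_def)
    \<comment> \<open>A link starting outside \<open>S\<close> comes from a minimal set. Two such
      links with the same first vertex come from intersecting minimal sets, which coincide by
      \<open>disj\<close>.\<close>
    have off_eq: "x = y" if xy': "x \<in> L" "y \<in> L" "fst x \<notin> S" "fst x = fst y" for x y
    proof -
      obtain K K' where K': "K \<in> \<K>" "x = p K" "K' \<in> \<K>" "y = p K'"
        using off[OF xy'(1)] off[OF xy'(2)] xy'(3,4) by auto
      have "fst (p K) \<in> K" "fst (p K') \<in> K'" using p(1)[OF K[OF K'(1)]] p(1)[OF K[OF K'(3)]] by auto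
      then have "K \<inter> K' \<noteq> {}" using xy'(4) K'(2,4) by auto
      then show ?thesis using disj K' by blast
    qed
    show "x = y"
    proof (cases "fst x \<in> S")
      case True
      with xy(3) have "fst y \<in> S" by simp
      from equal[OF xy(1) True] equal[OF xy(2) this] xy(3) show ?thesis by (simp add: prod_eq_iff)
    next
      case False
      show ?thesis by (rule off_eq[OF xy(1,2) False xy(3)])
    qed
  qed
  moreover have "inj_on snd L"
  proof (rule inj_onI)
    fix x y assume xy: "x \<in> L" "y \<in> L" "snd x = snd y"
    have equal: "fst x = snd x" if "x \<in> L" "snd x \<in> R" for x
      using that diag unfolding L_def by (auto simp: Id_on_def)
    have off_eq: "x = y" if xy': "x \<in> L" "y \<in> L" "snd x \<notin> R" "snd x = snd y" for x y
    proof -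
      obtain K K' where K': "K \<in> \<K>" "x = p K" "K' \<in> \<K>" "y = p K'"
        using off[OF xy'(1)] off[OF xy'(2)] xy'(3,4) by auto
      have "snd (p K) \<in> K" "snd (p K') \<in> K'" using p(2)[OF K[OF K'(1)]] p(2)[OF K[OF K'(3)]] by auto
      then have "K \<inter> K' \<noteq> {}" using xy'(4) K'(2,4) by auto
      then show ?thesis using disj K' by blast
    qed
    show "x = y"
    proof (cases "snd x \<in> R")
      case True
      with xy(3) have "snd y \<in> R" by simp
      from equal[OF xy(1) True] equal[OF xy(2) this] xy(3) show ?thesis by (simp add: prod_eq_iff)
    next
      case False
      show ?thesis by (rule off_eq[OF xy(1,2) False xy(3)])
    qed
  qed
  moreover have "\<forall>X\<in>\<C>. \<exists>u w. (u, w) \<in> L \<and> u \<in> X \<and> w \<in> X"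
  proof
    fix X assume X: "X \<in> \<C>"
    have "finite \<C>" using C assms(1) by (meson PowI finite_Pow_iff finite_subset subsetI)
    then obtain K where "K \<in> \<C>" "K \<subseteq> X" "\<forall>Y\<in>\<C>. Y \<subseteq> K \<longrightarrow> K = Y"
      using finite_has_minimal2[OF _ X] by metis
    then have "K \<in> \<K>" "p K \<in> L" unfolding \<K>_def L_def by auto
    with p(1,2)[OF \<open>K \<in> \<C>\<close>] \<open>K \<subseteq> X\<close>
    show "\<exists>u w. (u, w) \<in> L \<and> u \<in> X \<and> w \<in> X" by (metis IntD1 prod.collapse subsetD)
  qed
  ultimately show ?thesis unfolding L_def by (intro exI[of _ L]) (auto simp: L_def)
qed

section \<open>Choosing signs\<close>

text \<open>The next sign takes a sum 0 to 1 and a sum 1 to 0. Landing in \<open>{0, 1}\<close>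
  rather than \<open>{-1, 0, 1}\<close> fixes the direction of the leftover, which the next lemma
  exploits.\<close>

lemma parity_signs:
  fixes J :: "'a set"
  assumes "finite J"
  shows "\<exists>\<epsilon>::'a \<Rightarrow> int. (\<forall>i. \<epsilon> i = 1 \<or> \<epsilon> i = -1) \<and> sum \<epsilon> J \<in> {0, 1}"
  using assms
proof (induction J rule: finite_induct)
  case empty
  show ?case by (intro exI[of _ "\<lambda>_. 1"]) simp
next
  case (insert j J)
  then obtain \<epsilon> :: "'a \<Rightarrow> int" where e: "\<forall>i. \<epsilon> i = 1 \<or> \<epsilon> i = -1" "sum \<epsilon> J \<in> {0, 1}" by blast
  define s :: int where "s = (if sum \<epsilon> J = 0 then 1 else -1)"
  have "sum (\<epsilon>(j := s)) (insert j J) = s + sum \<epsilon> J"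
    using insert(1,2) by (simp add: sum.insert) (intro sum.cong, auto)
  then show ?case using e by (intro exI[of _ "\<epsilon>(j := s)"]) (auto simp: s_def)
qed

text \<open>In the application \<open>f\<close> counts edges and \<open>g\<close> counts edges and
  arcs together, so the three bounds concern edges, whole covers and arcs.\<close>

lemma balancing_signs:
  fixes f g :: "'a \<Rightarrow> int"
  assumes I: "finite I" and f: "\<And>i. i \<in> I \<Longrightarrow> \<bar>f i\<bar> \<le> 1" and g: "\<And>i. i \<in> I \<Longrightarrow> \<bar>g i\<bar> \<le> 1"
  shows "\<exists>\<epsilon>::'a \<Rightarrow> int. (\<forall>i. \<epsilon> i = 1 \<or> \<epsilon> i = -1) \<and> \<bar>\<Sum>i\<in>I. \<epsilon> i * f i\<bar> \<le> 2 \<and>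
    \<bar>\<Sum>i\<in>I. \<epsilon> i * g i\<bar> \<le> 1 \<and> \<bar>(\<Sum>i\<in>I. \<epsilon> i * g i) - (\<Sum>i\<in>I. \<epsilon> i * f i)\<bar> \<le> 2"
proof -
  define A where "A = {i\<in>I. f i * g i = 1}"
  define C where "C = {i\<in>I. f i * g i = -1}"
  define Z where "Z = {i\<in>I. f i \<noteq> 0 \<and> g i = 0}"
  define U where "U = {i\<in>I. f i = 0 \<and> g i \<noteq> 0}"
  have fin: "finite A" "finite C" "finite Z" "finite U" using I unfolding A_def C_def Z_def U_def by auto
  obtain eA :: "'a \<Rightarrow> int" where eA: "\<And>i. eA i = 1 \<or> eA i = -1" "sum eA A \<in> {0, 1}"
    using parity_signs[OF fin(1)] by blast
  obtain eC :: "'a \<Rightarrow> int" where eC: "\<And>i. eC i = 1 \<or> eC i = -1" "sum eC C \<in> {0, 1}"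
    using parity_signs[OF fin(2)] by blast
  obtain eZ :: "'a \<Rightarrow> int" where eZ: "\<And>i. eZ i = 1 \<or> eZ i = -1" "sum eZ Z \<in> {0, 1}"
    using parity_signs[OF fin(3)] by blast
  obtain eU :: "'a \<Rightarrow> int" where eU: "\<And>i. eU i = 1 \<or> eU i = -1" "sum eU U \<in> {0, 1}"
    using parity_signs[OF fin(4)] by blast
  \<comment> \<open>Let \<open>a\<close>, \<open>z\<close>, \<open>u\<close> in
    \<open>{0, 1}\<close> be the sums over \<open>A\<close>, \<open>Z\<close>, \<open>U\<close>. If
    the sum over \<open>C\<close> is 1, the signed sums of \<open>f\<close>, \<open>g\<close> and
    their difference become \<open>a + 1 - z\<close>, \<open>a - 1 + u\<close> and
    \<open>z + u - 2\<close>; if it is 0, they become \<open>a - z\<close>, \<open>a - u\<close> and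
    \<open>z - u\<close>.\<close>
  define s :: int where "s = (if sum eC C = 1 then 1 else -1)"
  define \<epsilon> where "\<epsilon> i = (if i \<in> A then f i * eA i else if i \<in> C then f i * eC i
    else if i \<in> Z then - f i * eZ i else if i \<in> U then s * g i * eU i else 1)" for i
  \<comment> \<open>Up to sign there are four nonzero vectors, and equal ones cancel in pairs. Of the at most
    four that remain, the signs below combine \<open>(1,1) + (1,-1) - (1,0) + s(0,1)\<close>.\<close>
  have s: "s = 1 \<or> s = -1" unfolding s_def by auto
  have vals: "f i = -1 \<or> f i = 0 \<or> f i = 1" "g i = -1 \<or> g i = 0 \<or> g i = 1" if "i \<in> I" for i
    using f[OF that] g[OF that] by linarith+
  have pm: "x * y = 1 \<or> x * y = -1" if "x = 1 \<or> x = -1" "y = 1 \<or> y = -1" for x y :: int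
    using that by auto
  have nzf: "f i = 1 \<or> f i = -1" if "i \<in> A \<union> C \<union> Z" for i
    using that vals(1)[of i] unfolding A_def C_def Z_def by auto
  have nzg: "g i = 1 \<or> g i = -1" if "i \<in> U" for i
    using that vals(2)[of i] unfolding U_def by auto
  have "\<epsilon> i = 1 \<or> \<epsilon> i = -1" for i
  proof -
    consider "i \<in> A" | "i \<notin> A" "i \<in> C" | "i \<notin> A" "i \<notin> C" "i \<in> Z"
      | "i \<notin> A" "i \<notin> C" "i \<notin> Z" "i \<in> U" | "i \<notin> A" "i \<notin> C" "i \<notin> Z" "i \<notin> U" by blast
    then show ?thesis
    proof cases
      case 1
      then show ?thesis using pm[OF nzf eA(1), of i i] by (simp add: \<epsilon>_def)
    next
      case 2
      then show ?thesis using pm[OF nzf eC(1), of i i] by (simp add: \<epsilon>_def)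
    next
      case 3
      then show ?thesis using pm[OF nzf eZ(1), of i i] by (auto simp: \<epsilon>_def)
    next
      case 4
      then show ?thesis using pm[OF pm[OF s nzg] eU(1), of i i] by (simp add: \<epsilon>_def)
    qed (simp add: \<epsilon>_def)
  qed
  moreover have F: "(\<Sum>i\<in>I. \<epsilon> i * f i) = sum eA A + sum eC C - sum eZ Z"
  proof -
    have "\<epsilon> i * f i = (if i \<in> A then eA i else 0) + (if i \<in> C then eC i else 0)
        - (if i \<in> Z then eZ i else 0)" if "i \<in> I" for i
      using vals[OF that] that
      by (elim disjE) (simp_all add: \<epsilon>_def A_def C_def Z_def U_def)
    then have "(\<Sum>i\<in>I. \<epsilon> i * f i) = (\<Sum>i\<in>I. if i \<in> A then eA i else 0)
        + (\<Sum>i\<in>I. if i \<in> C then eC i else 0) - (\<Sum>i\<in>I. if i \<in> Z then eZ i else 0)"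
      by (simp add: sum.distrib sum_subtractf)
    also have "\<dots> = sum eA (I \<inter> A) + sum eC (I \<inter> C) - sum eZ (I \<inter> Z)"
      using I by (simp add: sum.inter_restrict)
    also have "I \<inter> A = A" unfolding A_def by blast
    also have "I \<inter> C = C" unfolding C_def by blast
    also have "I \<inter> Z = Z" unfolding Z_def by blast
    finally show ?thesis .
  qed
  moreover have G: "(\<Sum>i\<in>I. \<epsilon> i * g i) = sum eA A - sum eC C + s * sum eU U"
  proof -
    have "\<epsilon> i * g i = (if i \<in> A then eA i else 0) - (if i \<in> C then eC i else 0)
        + s * (if i \<in> U then eU i else 0)" if "i \<in> I" for i
      using vals[OF that] that
      by (elim disjE) (simp_all add: \<epsilon>_def A_def C_def Z_def U_def)
    then have "(\<Sum>i\<in>I. \<epsilon> i * g i) = (\<Sum>i\<in>I. if i \<in> A then eA i else 0)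
        - (\<Sum>i\<in>I. if i \<in> C then eC i else 0) + s * (\<Sum>i\<in>I. if i \<in> U then eU i else 0)"
      by (simp add: sum.distrib sum_subtractf sum_distrib_left)
    also have "\<dots> = sum eA (I \<inter> A) - sum eC (I \<inter> C) + s * sum eU (I \<inter> U)"
      using I by (simp add: sum.inter_restrict)
    also have "I \<inter> A = A" unfolding A_def by blast
    also have "I \<inter> C = C" unfolding C_def by blast
    also have "I \<inter> U = U" unfolding U_def by blast
    finally show ?thesis .
  qed
  ultimately show ?thesis
    using eA(2) eC(2) eZ(2) eU(2) unfolding s_def by (intro exI[of _ \<epsilon>]) (elim insertE emptyE; simp)
qed

section \<open>Signed counts and the drop of the sum of squares\<close>

lemma sum_fibres:
  fixes \<epsilon> :: "'b \<Rightarrow> int"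
  assumes "finite A" "finite I" "\<And>x. x \<in> A \<Longrightarrow> \<kappa> x \<in> I"
  shows "(\<Sum>i\<in>I. \<epsilon> i * int (card {x\<in>A. \<kappa> x = i})) = (\<Sum>x\<in>A. \<epsilon> (\<kappa> x))"
proof -
  have "(\<Sum>x\<in>A. \<epsilon> (\<kappa> x)) = (\<Sum>i\<in>I. \<Sum>x\<in>{x\<in>A. \<kappa> x = i}. \<epsilon> (\<kappa> x))"
    by (rule sum.group[symmetric]) (use assms in auto)
  also have "\<dots> = (\<Sum>i\<in>I. \<epsilon> i * int (card {x\<in>A. \<kappa> x = i}))"
    by (intro sum.cong) auto
  finally show ?thesis by simp
qed

lemma sum_signs:
  fixes \<sigma> :: "'a \<Rightarrow> int"
  assumes "finite A" "\<And>x. x \<in> A \<Longrightarrow> \<sigma> x = 1 \<or> \<sigma> x = -1"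
  shows "sum \<sigma> A = int (card {x\<in>A. \<sigma> x = 1}) - int (card {x\<in>A. \<sigma> x = -1})"
proof -
  have "A = {x\<in>A. \<sigma> x = 1} \<union> {x\<in>A. \<sigma> x = -1}" using assms(2) by blast
  then have "sum \<sigma> A = sum \<sigma> ({x\<in>A. \<sigma> x = 1} \<union> {x\<in>A. \<sigma> x = -1})" by simp
  also have "\<dots> = sum \<sigma> {x\<in>A. \<sigma> x = 1} + sum \<sigma> {x\<in>A. \<sigma> x = -1}"
    by (rule sum.union_disjoint) (use assms(1) in auto)
  finally show ?thesis by simp
qed

text \<open>Elements of sign -1 change sides. An element of both sets carries equal signs, so it
  lands once on each side and the unions are disjoint. This serves the disjoint edge sets as well as
  the possibly overlapping root sets.\<close>

lemma card_swap_signs: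
  fixes \<sigma> :: "'a \<Rightarrow> int" and \<tau> :: "'a \<Rightarrow> int"
  assumes "finite A" "finite B"
    and \<sigma>: "\<And>x. x \<in> A \<Longrightarrow> \<sigma> x = 1 \<or> \<sigma> x = -1" and \<tau>: "\<And>x. x \<in> B \<Longrightarrow> \<tau> x = 1 \<or> \<tau> x = -1"
    and eq: "\<And>x. x \<in> A \<inter> B \<Longrightarrow> \<sigma> x = \<tau> x"
  shows "int (card ({x\<in>A. \<sigma> x = 1} \<union> {x\<in>B. \<tau> x = -1})) -
      int (card ({x\<in>A. \<sigma> x = -1} \<union> {x\<in>B. \<tau> x = 1})) = sum \<sigma> A - sum \<tau> B" (is ?diff)
    and "card ({x\<in>A. \<sigma> x = 1} \<union> {x\<in>B. \<tau> x = -1}) +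
      card ({x\<in>A. \<sigma> x = -1} \<union> {x\<in>B. \<tau> x = 1}) = card A + card B" (is ?total)
proof -
  have 1: "card ({x\<in>A. \<sigma> x = 1} \<union> {x\<in>B. \<tau> x = -1}) = card {x\<in>A. \<sigma> x = 1} + card {x\<in>B. \<tau> x = -1}"
    by (rule card_Un_disjoint) (use assms(1,2) eq in auto)
  have 2: "card ({x\<in>A. \<sigma> x = -1} \<union> {x\<in>B. \<tau> x = 1}) = card {x\<in>A. \<sigma> x = -1} + card {x\<in>B. \<tau> x = 1}"
    by (rule card_Un_disjoint) (use assms(1,2) eq in auto)
  have "card A = card ({x\<in>A. \<sigma> x = 1} \<union> {x\<in>A. \<sigma> x = -1})"
    by (rule arg_cong[where f = card]) (use \<sigma> in blast)
  also have "\<dots> = card {x\<in>A. \<sigma> x = 1} + card {x\<in>A. \<sigma> x = -1}"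
    by (rule card_Un_disjoint) (use assms(1) in auto)
  finally have A: "card A = card {x\<in>A. \<sigma> x = 1} + card {x\<in>A. \<sigma> x = -1}" .
  have "card B = card ({x\<in>B. \<tau> x = 1} \<union> {x\<in>B. \<tau> x = -1})"
    by (rule arg_cong[where f = card]) (use \<tau> in blast)
  also have "\<dots> = card {x\<in>B. \<tau> x = 1} + card {x\<in>B. \<tau> x = -1}"
    by (rule card_Un_disjoint) (use assms(2) in auto)
  finally have B: "card B = card {x\<in>B. \<tau> x = 1} + card {x\<in>B. \<tau> x = -1}" .
  show ?diff using sum_signs[OF assms(1) \<sigma>] sum_signs[OF assms(2) \<tau>] 1 2 by simp
  show ?total using A B 1 2 by simp
qed

text \<open>The balanced side is at most 4 + 4 + 4 = 12, which is below 16 if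
  \<open>\<bar>s\<bar> \<ge> 2\<close>. Otherwise parity gives
  \<open>\<bar>s'\<bar> \<le> \<bar>s\<bar>\<close>, and one of \<open>n\<close>, \<open>b\<close>
  has absolute value at least 3, the other at least 2, so their squares sum to at least 13 against
  at most 8.\<close>

lemma pair_squares_decrease:
  fixes s n b s' n' b' :: int
  assumes "s = n + b" "s' = n' + b'" "\<bar>s'\<bar> \<le> 1" "\<bar>n'\<bar> \<le> 2" "\<bar>b'\<bar> \<le> 2"
    and "even (s - s')" and bad: "\<not> (\<bar>s\<bar> \<le> 1 \<and> \<bar>n\<bar> \<le> 2 \<and> \<bar>b\<bar> \<le> 2)"
  shows "4 * s'\<^sup>2 + n'\<^sup>2 + b'\<^sup>2 < 4 * s\<^sup>2 + n\<^sup>2 + b\<^sup>2"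
proof -
  have le: "x\<^sup>2 \<le> y\<^sup>2" if "\<bar>x\<bar> \<le> \<bar>y\<bar>" for x y :: int using that by (simp add: abs_le_square_iff)
  have small: "s'\<^sup>2 \<le> 1" "n'\<^sup>2 \<le> 4" "b'\<^sup>2 \<le> 4" using le[of s' 1] le[of n' 2] le[of b' 2] assms by auto
  show ?thesis
  proof (cases "\<bar>s\<bar> \<le> 1")
    case False
    then have "4 \<le> s\<^sup>2" using le[of 2 s] by simp
    then show ?thesis using small zero_le_power2[of n] zero_le_power2[of b] by linarith
  next
    case True
    have "\<bar>s'\<bar> \<le> \<bar>s\<bar>" using assms(3,6) True by presburger
    then have "s'\<^sup>2 \<le> s\<^sup>2" by (rule le)
    moreover have "4 \<le> n\<^sup>2 \<and> 9 \<le> b\<^sup>2 \<or> 9 \<le> n\<^sup>2 \<and> 4 \<le> b\<^sup>2"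
    proof -
      have "2 \<le> \<bar>n\<bar> \<and> 3 \<le> \<bar>b\<bar> \<or> 3 \<le> \<bar>n\<bar> \<and> 2 \<le> \<bar>b\<bar>" using bad True assms(1) by linarith
      then show ?thesis using le[of 2 n] le[of 3 n] le[of 2 b] le[of 3 b] by auto
    qed
    ultimately show ?thesis using small by linarith
  qed
qed

section \<open>Two mixed edge covers\<close>

context mixed_graph
begin

text \<open>A walk from outside a set into it uses an entering arc. Conversely, the set of vertices
  not reachable from any endpoint of \<open>F \<inter> E\<close> contains no such endpoint and no
  arc of \<open>F\<close> enters it, so it is empty.\<close>

lemma mixed_edge_cover_iff:
  "mixed_edge_cover D E ends F \<longleftrightarrow> F \<subseteq> E \<union> arcs D \<and>
     spans (tail D) (head D) (verts D) (\<Union> (ends ` (F \<inter> E))) (F \<inter> arcs D)"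
proof -
  let ?D = "D\<lparr>arcs := F \<inter> arcs D\<rparr>"
  interpret F: wf_digraph ?D by unfold_locales auto
  have enters: "\<exists>a\<in>F \<inter> arcs D. head D a \<in> X \<and> tail D a \<notin> X"
    if "F.awalk u p v" "u \<notin> X" "v \<in> X" for u p v X
    using that
  proof (induction p arbitrary: u)
    case Nil
    then show ?case by (simp add: F.awalk_Nil_iff)
  next
    case (Cons a p)
    then show ?case by (cases "head D a \<in> X") (auto simp: F.awalk_Cons_iff)
  qed
  have "spans (tail D) (head D) (verts D) (\<Union> (ends ` (F \<inter> E))) (F \<inter> arcs D)"
    if c: "mixed_edge_cover D E ends F"
    unfolding spans_def
  proof (intro allI impI)
    fix X assume X: "X \<subseteq> verts D" "X \<noteq> {}" "X \<inter> \<Union> (ends ` (F \<inter> E)) = {}"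
    then obtain v where v: "v \<in> X" by blast
    with X c obtain e u p where "e \<in> F \<inter> E" "u \<in> ends e" "F.apath u p v"
      unfolding mixed_edge_cover_def by blast
    with X(3) v enters[of u p v X] show "\<exists>a\<in>F \<inter> arcs D. head D a \<in> X \<and> tail D a \<notin> X"
      unfolding F.apath_def by blast
  qed
  moreover have "mixed_edge_cover D E ends F"
    if F: "F \<subseteq> E \<union> arcs D"
      and s: "spans (tail D) (head D) (verts D) (\<Union> (ends ` (F \<inter> E))) (F \<inter> arcs D)"
  proof -
    define X where "X = {x \<in> verts D. \<forall>e\<in>F \<inter> E. \<forall>u\<in>ends e. \<not> u \<rightarrow>\<^sup>*\<^bsub>?D\<^esub> x}"
    have "X = {}"
    proof (rule ccontr)
      assume ne: "X \<noteq> {}"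
      have refl: "x \<rightarrow>\<^sup>*\<^bsub>?D\<^esub> x" if "x \<in> verts D" for x
        using F.reachable_refl[of x] that by simp
      then have disj: "X \<inter> \<Union> (ends ` (F \<inter> E)) = {}" unfolding X_def by blast
      have XV: "X \<subseteq> verts D" unfolding X_def by blast
      obtain a where a: "a \<in> F \<inter> arcs D" "head D a \<in> X" "tail D a \<notin> X"
        by (rule spansD[OF s XV ne disj])
      then obtain e u where eu: "e \<in> F \<inter> E" "u \<in> ends e" "u \<rightarrow>\<^sup>*\<^bsub>?D\<^esub> tail D a"
        using tail_in_verts[of a] unfolding X_def by blast
      have "tail D a \<rightarrow>\<^bsub>?D\<^esub> head D a"
        using a(1) F.in_arcs_imp_in_arcs_ends[of a] by simp
      then have "u \<rightarrow>\<^sup>*\<^bsub>?D\<^esub> head D a" using eu(3) F.reachable_adj_trans by blast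
      then show False using a(2) eu unfolding X_def by blast
    qed
    then have "\<exists>e\<in>F \<inter> E. \<exists>u\<in>ends e. \<exists>p. F.apath u p v" if "v \<in> verts D" for v
      using that F.reachable_apath unfolding X_def by blast
    then show ?thesis using F unfolding mixed_edge_cover_def by blast
  qed
  ultimately show ?thesis unfolding mixed_edge_cover_def by blast
qed

lemma rebalance_two_covers:
  assumes F: "mixed_edge_cover D E ends F1" "mixed_edge_cover D E ends F2" "F1 \<inter> F2 = {}"
  shows "\<exists>G1 G2. mixed_edge_cover D E ends G1 \<and> mixed_edge_cover D E ends G2 \<and>
    G1 \<inter> G2 = {} \<and> G1 \<union> G2 = F1 \<union> F2 \<and>
    \<bar>int (card G1) - int (card G2)\<bar> \<le> 1 \<and>
    \<bar>int (card (G1 \<inter> E)) - int (card (G2 \<inter> E))\<bar> \<le> 2 \<and>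
    \<bar>int (card (G1 \<inter> arcs D)) - int (card (G2 \<inter> arcs D))\<bar> \<le> 2"
proof -
  let ?V = "verts D" and ?h = "head D" and ?t = "tail D"
  define N1 where "N1 = F1 \<inter> E"
  define N2 where "N2 = F2 \<inter> E"
  define R1 where "R1 = \<Union> (ends ` N1)"
  define R2 where "R2 = \<Union> (ends ` N2)"
  have N: "N1 \<subseteq> E" "N2 \<subseteq> E" "N1 \<inter> N2 = {}" "finite N1" "finite N2"
    using F(3) finite_edges finite_subset unfolding N1_def N2_def by blast+
  have R: "R1 \<subseteq> ?V" "R2 \<subseteq> ?V"
    using N(1,2) ends_subset unfolding R1_def R2_def by blast+
  have finR: "finite R1" "finite R2" using R finite_verts finite_subset by blast+
  have sub: "F1 \<subseteq> E \<union> arcs D" "F2 \<subseteq> E \<union> arcs D"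
    using F(1,2) unfolding mixed_edge_cover_iff by auto
  have tV: "?t ` B \<subseteq> ?V" if "B \<subseteq> arcs D" for B using that by auto
  have finB: "finite B" if "B \<subseteq> arcs D" for B using that finite_arcs finite_subset by blast
  \<comment> \<open>The exact sizes of \<open>T1\<close> and \<open>T2\<close> are needed to count
    the arcs of the new branchings in \<open>cPQ\<close>.\<close>
  obtain T1 where T1: "T1 \<subseteq> F1 \<inter> arcs D" "spans ?t ?h ?V R1 T1" "card T1 = card (?V - R1)"
    using spans_minimal[OF finite_verts finB[of "F1 \<inter> arcs D"] tV[of "F1 \<inter> arcs D"], of ?h R1] F(1)
    unfolding mixed_edge_cover_iff R1_def N1_def by auto
  obtain T2 where T2: "T2 \<subseteq> F2 \<inter> arcs D" "spans ?t ?h ?V R2 T2" "card T2 = card (?V - R2)"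
    using spans_minimal[OF finite_verts finB[of "F2 \<inter> arcs D"] tV[of "F2 \<inter> arcs D"], of ?h R2] F(2)
    unfolding mixed_edge_cover_iff R2_def N2_def by auto
  define T where "T = T1 \<union> T2"
  define X where "X = (F1 \<union> F2) \<inter> arcs D - T"
  have TX: "T \<subseteq> arcs D" "X \<subseteq> arcs D" "T \<inter> X = {}" "T1 \<inter> T2 = {}"
    using T1(1) T2(1) F(3) unfolding T_def X_def by blast+
  note finTX = finB[OF TX(1)] finB[OF TX(2)]
  have finT12: "finite T1" "finite T2" using finTX(1) unfolding T_def by auto
  have FX: "F1 \<union> F2 = N1 \<union> N2 \<union> T \<union> X"
    using T1(1) T2(1) sub unfolding T_def X_def N1_def N2_def by blast
  \<comment> \<open>These sets are entered by no arc of \<open>T\<close>, so each must contain a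
    root of both new branchings; a link inside it, with ends on different sides, will guarantee
    this.\<close>
  define \<C> where "\<C> = {Y. Y \<subseteq> ?V \<and> Y \<noteq> {} \<and> (\<forall>a\<in>T. \<not> (?h a \<in> Y \<and> ?t a \<notin> Y))}"
  have "\<exists>L\<subseteq>R1 \<times> R2. inj_on fst L \<and> inj_on snd L \<and> (\<forall>v\<in>R1 \<inter> R2. (v, v) \<in> L) \<and>
    (\<forall>Y\<in>\<C>. \<exists>u w. (u, w) \<in> L \<and> u \<in> Y \<and> w \<in> Y)"
  proof (rule links_exist[OF finite_verts])
    fix Y assume Y: "Y \<in> \<C>"
    show "Y \<subseteq> ?V" using Y unfolding \<C>_def by blast
    show "Y \<inter> R1 \<noteq> {}"
    proof
      assume "Y \<inter> R1 = {}"
      with Y obtain a where "a \<in> T1" "?h a \<in> Y" "?t a \<notin> Y"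
        using spansD[OF T1(2), of Y] unfolding \<C>_def by auto
      with Y show False unfolding \<C>_def T_def by blast
    qed
    show "Y \<inter> R2 \<noteq> {}"
    proof
      assume "Y \<inter> R2 = {}"
      with Y obtain a where "a \<in> T2" "?h a \<in> Y" "?t a \<notin> Y"
        using spansD[OF T2(2), of Y] unfolding \<C>_def by auto
      with Y show False unfolding \<C>_def T_def by blast
    qed
  next
    fix Y Z assume "Y \<in> \<C>" "Z \<in> \<C>" "Y \<inter> Z \<noteq> {}"
    then show "Y \<inter> Z \<in> \<C>" unfolding \<C>_def by blast
  qed
  then obtain L where L: "L \<subseteq> R1 \<times> R2" "inj_on fst L" "inj_on snd L"
    "\<forall>v\<in>R1 \<inter> R2. (v, v) \<in> L" "\<forall>Y\<in>\<C>. \<exists>u w. (u, w) \<in> L \<and> u \<in> Y \<and> w \<in> Y"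
    by (elim exE conjE) (rule that)
  have finL: "finite L" using L(1) finR finite_subset by blast
  \<comment> \<open>Each root is tied to one incident edge and will move with it.\<close>
  have "\<forall>v\<in>R1. \<exists>e. e \<in> N1 \<and> v \<in> ends e" unfolding R1_def by blast
  from bchoice[OF this] obtain e1 where e1: "\<And>v. v \<in> R1 \<Longrightarrow> e1 v \<in> N1 \<and> v \<in> ends (e1 v)"
    by blast
  have "\<forall>v\<in>R2. \<exists>e. e \<in> N2 \<and> v \<in> ends e" unfolding R2_def by blast
  from bchoice[OF this] obtain e2 where e2: "\<And>v. v \<in> R2 \<Longrightarrow> e2 v \<in> N2 \<and> v \<in> ends (e2 v)"
    by blast
  have "e1 (fst l) \<in> N1 \<union> N2" if "l \<in> L" for l using that L(1) e1 by auto
  then obtain \<kappa> where \<kappa>: "\<And>e. e \<in> N1 \<union> N2 \<Longrightarrow> \<kappa> e \<in> N1 \<union> N2"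
      "\<And>l. l \<in> L \<Longrightarrow> \<kappa> (e1 (fst l)) = \<kappa> (e2 (snd l))"
      "\<And>i. card {e\<in>N1 \<union> N2. \<kappa> e = i} \<le> card {l\<in>L. \<kappa> (e1 (fst l)) = i} + 1"
    using link_classes[OF finL, of "N1 \<union> N2" "\<lambda>l. e1 (fst l)" "\<lambda>l. e2 (snd l)"] N(4,5) by blast
  have \<kappa>L: "\<kappa> (e1 u) = \<kappa> (e2 w)" if "(u, w) \<in> L" for u w using \<kappa>(2)[OF that] by simp
  define c1 where "c1 i = card {e\<in>N1. \<kappa> e = i}" for i
  define c2 where "c2 i = card {e\<in>N2. \<kappa> e = i}" for i
  \<comment> \<open>A branching has one arc less for every additional root, so up to a constant
    edges minus roots counts the edges and branching arcs of a side. A class thus contributes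
    \<open>c1 - q1\<close> against \<open>c2 - q2\<close>.\<close>
  define q1 where "q1 i = card {v\<in>R1. \<kappa> (e1 v) = i}" for i
  define q2 where "q2 i = card {v\<in>R2. \<kappa> (e2 v) = i}" for i
  have bounds: "\<bar>int (c1 i) - int (c2 i)\<bar> \<le> 1"
      "\<bar>int (c1 i) - int (c2 i) - int (q1 i) + int (q2 i)\<bar> \<le> 1" for i
  proof -
    define l where "l = card {l\<in>L. \<kappa> (e1 (fst l)) = i}"
    have deg: "card {v\<in>R. \<kappa> (e v) = i} \<le> 2 * card {e\<in>M. \<kappa> e = i}"
      if e: "\<And>v. v \<in> R \<Longrightarrow> e v \<in> M \<and> v \<in> ends (e v)" and M: "M \<subseteq> E" for R e M
    proof -
      let ?M = "{e\<in>M. \<kappa> e = i}"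
      have fM: "finite ?M" using M finite_edges by (simp add: finite_subset)
      have "{v\<in>R. \<kappa> (e v) = i} \<subseteq> \<Union> (ends ` ?M)" using e by blast
      moreover have "finite (ends x)" if "x \<in> M" for x
        using card_ends[of x] that M by (metis card.infinite subsetD zero_neq_numeral)
      ultimately have "card {v\<in>R. \<kappa> (e v) = i} \<le> card (\<Union> (ends ` ?M))"
        using fM by (intro card_mono) auto
      also have "\<dots> \<le> (\<Sum>x\<in>?M. card (ends x))" by (rule card_UN_le[OF fM])
      also have "\<dots> = (\<Sum>x\<in>?M. 2)" by (intro sum.cong) (use M card_ends in auto)
      finally show ?thesis by (simp add: mult.commute)
    qed
    have "q1 i \<le> 2 * c1 i" unfolding q1_def c1_def by (rule deg[OF e1 N(1)])
    moreover have "q2 i \<le> 2 * c2 i" unfolding q2_def c2_def by (rule deg[OF e2 N(2)])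
    moreover have "l \<le> q1 i" unfolding l_def q1_def
      by (rule card_inj_on_le[of fst]) (use L(1,2) finR in \<open>auto intro: inj_on_subset\<close>)
    moreover have "l \<le> q2 i" unfolding l_def q2_def
      by (rule card_inj_on_le[of snd]) (use L(1,3) finR \<kappa>L in \<open>auto intro: inj_on_subset\<close>)
    moreover have "c1 i + c2 i \<le> l + 1"
    proof -
      have "{e\<in>N1 \<union> N2. \<kappa> e = i} = {e\<in>N1. \<kappa> e = i} \<union> {e\<in>N2. \<kappa> e = i}" by blast
      moreover have "card \<dots> = c1 i + c2 i"
        unfolding c1_def c2_def by (rule card_Un_disjoint) (use N in auto)
      ultimately show ?thesis using \<kappa>(3)[of i] unfolding l_def by simp
    qed
    \<comment> \<open>Degrees: \<open>l \<le> q \<le> 2c\<close> on both sides, so \<open>2c1 - l\<close> and \<open>2c2 - l\<close> are nonnegative with sum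
      at most 2.\<close>
    ultimately show "\<bar>int (c1 i) - int (c2 i)\<bar> \<le> 1"
      "\<bar>int (c1 i) - int (c2 i) - int (q1 i) + int (q2 i)\<bar> \<le> 1" by linarith+
  qed
  define f where "f i = int (c1 i) - int (c2 i)" for i
  \<comment> \<open>Classes are named by edges and free arcs by themselves. As
    \<open>\<kappa>\<close> maps edges to edges, an index in \<open>X\<close> has empty classes and
    contributes only its arc, the vector \<open>(0, 1)\<close>.\<close>
  define g where "g i = int (c1 i) - int (c2 i) - int (q1 i) + int (q2 i) + (if i \<in> X then 1 else 0)" for i
  define I where "I = N1 \<union> N2 \<union> X"
  have finI: "finite I" using N finTX unfolding I_def by blast
  have NX: "(N1 \<union> N2) \<inter> X = {}" "(N1 \<union> N2) \<inter> T = {}"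
    using N TX edges_arcs_disjoint by blast+
  have "\<bar>g i\<bar> \<le> 1" for i
  proof (cases "i \<in> X")
    case True
    then have "i \<notin> N1 \<union> N2" using NX by blast
    then have "{e\<in>N1. \<kappa> e = i} = {}" "{e\<in>N2. \<kappa> e = i} = {}"
      "{v\<in>R1. \<kappa> (e1 v) = i} = {}" "{v\<in>R2. \<kappa> (e2 v) = i} = {}"
      using \<kappa>(1) e1 e2 by blast+
    then have "c1 i = 0" "c2 i = 0" "q1 i = 0" "q2 i = 0"
      unfolding c1_def c2_def q1_def q2_def by (simp_all only: card.empty)
    then show ?thesis unfolding g_def by simp
  next
    case False
    then show ?thesis using bounds(2)[of i] unfolding g_def by simp
  qed
  moreover have "\<bar>f i\<bar> \<le> 1" for i using bounds(1)[of i] unfolding f_def .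
  ultimately obtain \<epsilon> where \<epsilon>: "\<And>i. \<epsilon> i = 1 \<or> \<epsilon> i = -1"
      "\<bar>\<Sum>i\<in>I. \<epsilon> i * f i\<bar> \<le> 2" "\<bar>\<Sum>i\<in>I. \<epsilon> i * g i\<bar> \<le> 1"
      "\<bar>(\<Sum>i\<in>I. \<epsilon> i * g i) - (\<Sum>i\<in>I. \<epsilon> i * f i)\<bar> \<le> 2"
    using balancing_signs[OF finI, of f g] by blast
  define \<delta> where "\<delta> e = \<epsilon> (\<kappa> e)" for e
  have \<delta>: "\<delta> e = 1 \<or> \<delta> e = -1" for e unfolding \<delta>_def by (rule \<epsilon>(1))
  have \<delta>L: "\<delta> (e1 u) = \<delta> (e2 w)" if "(u, w) \<in> L" for u w unfolding \<delta>_def using \<kappa>L[OF that] by simp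
  have "(\<Sum>i\<in>I. \<epsilon> i * int (c1 i)) = sum \<delta> N1"
    unfolding c1_def \<delta>_def by (rule sum_fibres) (use N finI \<kappa>(1) in \<open>auto simp: I_def\<close>)
  moreover have "(\<Sum>i\<in>I. \<epsilon> i * int (c2 i)) = sum \<delta> N2"
    unfolding c2_def \<delta>_def by (rule sum_fibres) (use N finI \<kappa>(1) in \<open>auto simp: I_def\<close>)
  moreover have "(\<Sum>i\<in>I. \<epsilon> i * int (q1 i)) = (\<Sum>v\<in>R1. \<delta> (e1 v))"
    unfolding q1_def \<delta>_def by (rule sum_fibres) (use finR finI \<kappa>(1) e1 in \<open>auto simp: I_def\<close>)
  moreover have "(\<Sum>i\<in>I. \<epsilon> i * int (q2 i)) = (\<Sum>v\<in>R2. \<delta> (e2 v))"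
    unfolding q2_def \<delta>_def by (rule sum_fibres) (use finR finI \<kappa>(1) e2 in \<open>auto simp: I_def\<close>)
  moreover have "(\<Sum>i\<in>I. \<epsilon> i * (if i \<in> X then 1 else 0)) = sum \<epsilon> X"
  proof -
    have "(\<Sum>i\<in>I. \<epsilon> i * (if i \<in> X then 1 else 0)) = (\<Sum>i\<in>I. if i \<in> X then \<epsilon> i else 0)"
      by (intro sum.cong) auto
    also have "\<dots> = sum \<epsilon> (I \<inter> X)" using finI by (simp add: sum.inter_restrict)
    also have "I \<inter> X = X" unfolding I_def by blast
    finally show ?thesis .
  qed
  ultimately have
    sumf: "(\<Sum>i\<in>I. \<epsilon> i * f i) = sum \<delta> N1 - sum \<delta> N2" and
    sumg: "(\<Sum>i\<in>I. \<epsilon> i * g i) = sum \<delta> N1 - sum \<delta> N2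
      - (\<Sum>v\<in>R1. \<delta> (e1 v)) + (\<Sum>v\<in>R2. \<delta> (e2 v)) + sum \<epsilon> X"
    unfolding f_def g_def by (simp_all only: distrib_left right_diff_distrib sum.distrib sum_subtractf)
  \<comment> \<open>Sign -1 swaps sides. Roots take the sign of their chosen edge, so every new root
    is an endpoint of a new edge on its side.\<close>
  define M1 where "M1 = {e\<in>N1. \<delta> e = 1} \<union> {e\<in>N2. \<delta> e = -1}"
  define M2 where "M2 = {e\<in>N1. \<delta> e = -1} \<union> {e\<in>N2. \<delta> e = 1}"
  define S1 where "S1 = {v\<in>R1. \<delta> (e1 v) = 1} \<union> {v\<in>R2. \<delta> (e2 v) = -1}"
  define S2 where "S2 = {v\<in>R1. \<delta> (e1 v) = -1} \<union> {v\<in>R2. \<delta> (e2 v) = 1}"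
  define X1 where "X1 = {x\<in>X. \<epsilon> x = 1}"
  define X2 where "X2 = {x\<in>X. \<epsilon> x = -1}"
  have cM: "int (card M1) - int (card M2) = sum \<delta> N1 - sum \<delta> N2"
    unfolding M1_def M2_def by (rule card_swap_signs(1)) (use N \<delta> in auto)
  \<comment> \<open>The diagonal links give the two chosen edges of a common root equal signs, so it
    remains a root on both sides.\<close>
  have cS: "int (card S1) - int (card S2) = (\<Sum>v\<in>R1. \<delta> (e1 v)) - (\<Sum>v\<in>R2. \<delta> (e2 v))"
      "card S1 + card S2 = card R1 + card R2"
    unfolding S1_def S2_def by (rule card_swap_signs; use finR \<delta> \<delta>L L(4) in auto)+
  have cX: "int (card X1) - int (card X2) = sum \<epsilon> X"
    unfolding X1_def X2_def using sum_signs[OF finTX(2), of \<epsilon>] \<epsilon>(1) by simp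
  have S_M: "S1 \<subseteq> \<Union> (ends ` M1)" "S2 \<subseteq> \<Union> (ends ` M2)"
    using e1 e2 unfolding S1_def S2_def M1_def M2_def by blast+
  have S_V: "S1 \<subseteq> ?V" "S2 \<subseteq> ?V" using R unfolding S1_def S2_def by blast+
  have RS: "R1 \<union> R2 \<subseteq> S1 \<union> S2" using \<delta> unfolding S1_def S2_def by blast
  have "splittable ?t ?h ?V S1 S2 T"
    unfolding splittable_def
  proof (intro allI impI)
    fix Y assume Y: "Y \<subseteq> ?V" "Y \<noteq> {}"
    show "(if Y \<inter> S1 = {} then 1 else 0) + (if Y \<inter> S2 = {} then 1 else 0) \<le> indeg ?t ?h T Y"
    \<comment> \<open>In a set of \<open>\<C>\<close> the ends of a link have equal signs but start
      on different sides, so both new root sets are met. Any other set has an entering arc, which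
      suffices unless it misses both root sets; then it misses \<open>R1\<close> and
      \<open>R2\<close>, and \<open>T1\<close> and \<open>T2\<close> each supply an arc.\<close>
    proof (cases "Y \<in> \<C>")
      case True
      then obtain u w where uw: "(u, w) \<in> L" "u \<in> Y" "w \<in> Y" using L(5) by blast
      then have "u \<in> R1" "w \<in> R2" using L(1) by auto
      then have "Y \<inter> S1 \<noteq> {}" "Y \<inter> S2 \<noteq> {}"
        using uw(2,3) \<delta>[of "e1 u"] \<delta>L[OF uw(1)] unfolding S1_def S2_def by auto
      then show ?thesis by simp
    next
      case False
      let ?in = "{a\<in>T. ?h a \<in> Y \<and> ?t a \<notin> Y}"
      have fin: "finite ?in" using finTX by simp
      obtain a where a: "a \<in> ?in" using False Y unfolding \<C>_def by blast
      show ?thesis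
      proof (cases "Y \<inter> S1 = {} \<and> Y \<inter> S2 = {}")
        case True
        then have "Y \<inter> R1 = {}" "Y \<inter> R2 = {}" using RS by blast+
        then obtain b c where "b \<in> T1" "c \<in> T2" "b \<in> ?in" "c \<in> ?in"
          using spansD[OF T1(2) Y] spansD[OF T2(2) Y] unfolding T_def by (metis (lifting) UnI1 UnI2 mem_Collect_eq)
        then have bc: "b \<noteq> c" "{b, c} \<subseteq> ?in" using TX(4) by blast+
        have "card {b, c} \<le> card ?in" by (rule card_mono[OF fin bc(2)])
        then have "2 \<le> card ?in" using bc(1) by simp
        then show ?thesis unfolding indeg_def by simp
      next
        case False
        have "card ?in \<noteq> 0" using a unfolding card_0_eq[OF fin] by blast
        then show ?thesis using False unfolding indeg_def by auto
      qed
    qed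
  qed
  from edmonds_two_branchings[OF finite_verts finTX(1) tV[OF TX(1)] this]
  obtain P Q where PQ: "P \<inter> Q = {}" "P \<union> Q = T" "spans ?t ?h ?V S1 P" "spans ?t ?h ?V S2 Q"
    by (elim exE conjE) (rule that)
  have PQarcs: "P \<subseteq> arcs D" "Q \<subseteq> arcs D" using PQ(2) TX(1) by blast+
  note finPQ = finB[OF PQarcs(1)] finB[OF PQarcs(2)]
  \<comment> \<open>Both branchings have at least as many arcs as non-roots, and since the total
    numbers of roots and arcs are unchanged, both bounds are tight.\<close>
  have cPQ: "int (card P) - int (card Q) = int (card S2) - int (card S1)"
  proof -
    have "card (?V - S1) \<le> card P" "card (?V - S2) \<le> card Q"
      using spans_card_ge[OF finite_verts finPQ(1) tV PQ(3)]
        spans_card_ge[OF finite_verts finPQ(2) tV PQ(4)] PQarcs by blast+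
    moreover have "card P + card Q = card (?V - R1) + card (?V - R2)"
      using card_Un_disjoint[OF finPQ PQ(1)] card_Un_disjoint[OF finT12 TX(4)] PQ(2) T1(3) T2(3)
      unfolding T_def by simp
    moreover have "card Z + card (?V - Z) = card ?V" if "Z \<subseteq> ?V" for Z
      using card_Diff_subset[OF finite_subset[OF that finite_verts] that]
        card_mono[OF finite_verts that] by simp
    note this[OF R(1)] this[OF R(2)] this[OF S_V(1)] this[OF S_V(2)] cS(2)
    ultimately show ?thesis by linarith
  qed
  define G1 where "G1 = M1 \<union> P \<union> X1"
  define G2 where "G2 = M2 \<union> Q \<union> X2"
  have sub': "M1 \<subseteq> E" "M2 \<subseteq> E" "P \<union> X1 \<subseteq> arcs D" "Q \<union> X2 \<subseteq> arcs D"
    using N TX PQ(2) unfolding M1_def M2_def X1_def X2_def by blast+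
  have GE: "G1 \<inter> E = M1" "G2 \<inter> E = M2" "G1 \<inter> arcs D = P \<union> X1" "G2 \<inter> arcs D = Q \<union> X2"
    using sub' edges_arcs_disjoint unfolding G1_def G2_def by blast+
  have "mixed_edge_cover D E ends G1"
    unfolding mixed_edge_cover_iff GE using sub' spans_mono[OF PQ(3) S_M(1) Un_upper1] unfolding G1_def by blast
  moreover have "mixed_edge_cover D E ends G2"
    unfolding mixed_edge_cover_iff GE using sub' spans_mono[OF PQ(4) S_M(2) Un_upper1] unfolding G2_def by blast
  moreover have "G1 \<inter> G2 = {}"
  proof -
    have "M1 \<inter> M2 = {}" using N(3) unfolding M1_def M2_def by force
    moreover have "X1 \<inter> X2 = {}" unfolding X1_def X2_def by force
    moreover have "(P \<union> Q) \<inter> (X1 \<union> X2) = {}" using PQ(2) TX(3) unfolding X1_def X2_def by blast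
    moreover have "(M1 \<union> M2) \<inter> (P \<union> Q \<union> X1 \<union> X2) = {}" using sub' edges_arcs_disjoint by blast
    ultimately show ?thesis using PQ(1) unfolding G1_def G2_def by blast
  qed
  moreover have "G1 \<union> G2 = F1 \<union> F2"
  proof -
    have "M1 \<union> M2 = N1 \<union> N2" using \<delta> unfolding M1_def M2_def by blast
    moreover have "X1 \<union> X2 = X" using \<epsilon>(1) unfolding X1_def X2_def by blast
    ultimately show ?thesis unfolding FX G1_def G2_def using PQ(2) by blast
  qed
  moreover have diffs: "int (card M1) - int (card M2) = (\<Sum>i\<in>I. \<epsilon> i * f i)"
    "int (card (P \<union> X1)) - int (card (Q \<union> X2)) = (\<Sum>i\<in>I. \<epsilon> i * g i) - (\<Sum>i\<in>I. \<epsilon> i * f i)"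
    "int (card G1) - int (card G2) = (\<Sum>i\<in>I. \<epsilon> i * g i)"
  proof -
    have fin: "finite M1" "finite M2" "finite X1" "finite X2"
      using N(4,5) finTX unfolding M1_def M2_def X1_def X2_def by auto
    have "card (P \<union> X1) = card P + card X1" "card (Q \<union> X2) = card Q + card X2"
      using PQ(2) TX(3) fin finPQ unfolding X1_def X2_def by (auto intro!: card_Un_disjoint)
    moreover have "card G1 = card M1 + card (P \<union> X1)" "card G2 = card M2 + card (Q \<union> X2)"
      using card_Un_disjoint[of M1 "P \<union> X1"] card_Un_disjoint[of M2 "Q \<union> X2"] fin finPQ sub'
        edges_arcs_disjoint unfolding G1_def G2_def Un_assoc by blast+
    ultimately show "int (card M1) - int (card M2) = (\<Sum>i\<in>I. \<epsilon> i * f i)"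
      "int (card (P \<union> X1)) - int (card (Q \<union> X2)) = (\<Sum>i\<in>I. \<epsilon> i * g i) - (\<Sum>i\<in>I. \<epsilon> i * f i)"
      "int (card G1) - int (card G2) = (\<Sum>i\<in>I. \<epsilon> i * g i)"
      using sumf sumg cM cS(1) cX cPQ by linarith+
  qed
  ultimately show ?thesis
    using \<epsilon>(2-4) GE by (intro exI[of _ G1] exI[of _ G2]) (simp only: diffs GE simp_thms)
qed

section \<open>Partitions of minimal weight\<close>

definition cover_weight :: "'e set \<Rightarrow> nat" where
  "cover_weight F = 4 * (card F)\<^sup>2 + (card (F \<inter> E))\<^sup>2 + (card (F \<inter> arcs D))\<^sup>2"

lemma card_split_cover:
  assumes "mixed_edge_cover D E ends F"
  shows "card F = card (F \<inter> E) + card (F \<inter> arcs D)"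
proof -
  have F: "F = (F \<inter> E) \<union> (F \<inter> arcs D)" using assms unfolding mixed_edge_cover_def by blast
  have "card ((F \<inter> E) \<union> (F \<inter> arcs D)) = card (F \<inter> E) + card (F \<inter> arcs D)"
    by (rule card_Un_disjoint) (use finite_edges finite_arcs edges_arcs_disjoint in auto)
  then show ?thesis using F by simp
qed

text \<open>By \<open>2 * (x\<^sup>2 + y\<^sup>2) = (x + y)\<^sup>2 + (x - y)\<^sup>2\<close> and
  because both pairs partition the same set, only the squared differences matter. Equal totals also
  make the differences of the cover sizes congruent modulo 2.\<close>

lemma cover_weight_decrease:
  assumes F: "mixed_edge_cover D E ends F1" "mixed_edge_cover D E ends F2" "F1 \<inter> F2 = {}"
    and G: "mixed_edge_cover D E ends G1" "mixed_edge_cover D E ends G2" "G1 \<inter> G2 = {}"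
    and eq: "G1 \<union> G2 = F1 \<union> F2"
    and bal: "\<bar>int (card G1) - int (card G2)\<bar> \<le> 1"
      "\<bar>int (card (G1 \<inter> E)) - int (card (G2 \<inter> E))\<bar> \<le> 2"
      "\<bar>int (card (G1 \<inter> arcs D)) - int (card (G2 \<inter> arcs D))\<bar> \<le> 2"
    and bad: "\<not> (\<bar>int (card F1) - int (card F2)\<bar> \<le> 1 \<and>
      \<bar>int (card (F1 \<inter> E)) - int (card (F2 \<inter> E))\<bar> \<le> 2 \<and>
      \<bar>int (card (F1 \<inter> arcs D)) - int (card (F2 \<inter> arcs D))\<bar> \<le> 2)"
  shows "cover_weight G1 + cover_weight G2 < cover_weight F1 + cover_weight F2"
proof -
  have tot: "card (G1 \<inter> S) + card (G2 \<inter> S) = card (F1 \<inter> S) + card (F2 \<inter> S)"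
    if S: "finite S" for S
  proof -
    have "card (G1 \<inter> S) + card (G2 \<inter> S) = card ((G1 \<union> G2) \<inter> S)"
      unfolding Int_Un_distrib2 by (rule card_Un_disjoint[symmetric]) (use S G(3) in auto)
    also have "\<dots> = card (F1 \<inter> S) + card (F2 \<inter> S)"
      unfolding eq Int_Un_distrib2 by (rule card_Un_disjoint) (use S F(3) in auto)
    finally show ?thesis .
  qed
  note n = tot[OF finite_edges] and b = tot[OF finite_arcs]
  note c = card_split_cover[OF F(1)] card_split_cover[OF F(2)]
    card_split_cover[OF G(1)] card_split_cover[OF G(2)]
  define d where "d x y = int x - int y" for x y :: nat
  have sq: "2 * (int (x\<^sup>2) + int (y\<^sup>2)) = (int (x + y))\<^sup>2 + (d x y)\<^sup>2" for x y
    unfolding d_def by (simp add: power2_eq_square algebra_simps)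
  have weight: "2 * int (cover_weight X + cover_weight Y) =
      4 * (int (card X + card Y))\<^sup>2 + (int (card (X \<inter> E) + card (Y \<inter> E)))\<^sup>2 +
      (int (card (X \<inter> arcs D) + card (Y \<inter> arcs D)))\<^sup>2 +
      (4 * (d (card X) (card Y))\<^sup>2 + (d (card (X \<inter> E)) (card (Y \<inter> E)))\<^sup>2 +
      (d (card (X \<inter> arcs D)) (card (Y \<inter> arcs D)))\<^sup>2)" for X Y
    unfolding cover_weight_def using sq[of "card X" "card Y"]
      sq[of "card (X \<inter> E)" "card (Y \<inter> E)"] sq[of "card (X \<inter> arcs D)" "card (Y \<inter> arcs D)"] by simp
  have s: "card G1 + card G2 = card F1 + card F2" using n b c by simp
  have even: "even (d (card F1) (card F2) - d (card G1) (card G2))"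
    unfolding d_def using s by presburger
  have "4 * (d (card G1) (card G2))\<^sup>2 + (d (card (G1 \<inter> E)) (card (G2 \<inter> E)))\<^sup>2 +
        (d (card (G1 \<inter> arcs D)) (card (G2 \<inter> arcs D)))\<^sup>2
      < 4 * (d (card F1) (card F2))\<^sup>2 + (d (card (F1 \<inter> E)) (card (F2 \<inter> E)))\<^sup>2 +
        (d (card (F1 \<inter> arcs D)) (card (F2 \<inter> arcs D)))\<^sup>2"
  proof (rule pair_squares_decrease[OF _ _ _ _ _ even])
    show "d (card F1) (card F2) =
        d (card (F1 \<inter> E)) (card (F2 \<inter> E)) + d (card (F1 \<inter> arcs D)) (card (F2 \<inter> arcs D))"
      unfolding d_def c by simp
    show "d (card G1) (card G2) =
        d (card (G1 \<inter> E)) (card (G2 \<inter> E)) + d (card (G1 \<inter> arcs D)) (card (G2 \<inter> arcs D))"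
      unfolding d_def c by simp
  qed (unfold d_def, (rule bal bad)+)
  then have "2 * int (cover_weight G1 + cover_weight G2) < 2 * int (cover_weight F1 + cover_weight F2)"
    unfolding weight s n b by linarith
  then show ?thesis by simp
qed

lemma cover_partition_update:
  assumes F: "mixed_edge_cover_partition D E ends k F"
    and ij: "i \<in> {1..k}" "j \<in> {1..k}" "i \<noteq> j"
    and G: "mixed_edge_cover D E ends G1" "mixed_edge_cover D E ends G2" "G1 \<inter> G2 = {}"
    and eq: "G1 \<union> G2 = F i \<union> F j"
  shows "mixed_edge_cover_partition D E ends k (F(i := G1, j := G2))"
proof -
  let ?G = "F(i := G1, j := G2)"
  have disj: "F l \<inter> F m = {}" if "l \<in> {1..k}" "m \<in> {1..k}" "l \<noteq> m" for l m
    using F that unfolding mixed_edge_cover_partition_def disjoint_family_on_def by simp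
  have split: "{1..k} = insert i (insert j ({1..k} - {i, j}))" using ij by blast
  have "(\<Union>l\<in>{1..k}. ?G l) = G1 \<union> (G2 \<union> (\<Union>l\<in>{1..k} - {i, j}. ?G l))"
    by (subst split) (simp only: UN_insert, simp add: ij(3))
  also have "\<dots> = (F i \<union> F j) \<union> (\<Union>l\<in>{1..k} - {i, j}. F l)" using eq by auto
  also have "\<dots> = (\<Union>l\<in>{1..k}. F l)" by (subst (2) split) (simp only: UN_insert Un_assoc)
  also have "\<dots> = E \<union> arcs D" using F unfolding mixed_edge_cover_partition_def by simp
  finally have "(\<Union>l\<in>{1..k}. ?G l) = E \<union> arcs D" .
  moreover have "disjoint_family_on ?G {1..k}"
    unfolding disjoint_family_on_def
  proof (intro ballI impI)
    fix l m assume lm: "l \<in> {1..k}" "m \<in> {1..k}" "l \<noteq> m"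
    have out: "F l \<inter> G1 = {}" "F l \<inter> G2 = {}" if "l \<in> {1..k}" "l \<noteq> i" "l \<noteq> j" for l
      using disj[OF that(1) ij(1) that(2)] disj[OF that(1) ij(2) that(3)] eq by blast+
    show "?G l \<inter> ?G m = {}"
      using out[of l] out[of m] lm disj[OF lm] G(3) by (auto simp: Int_commute)
  qed
  moreover have "\<forall>l\<in>{1..k}. mixed_edge_cover D E ends (?G l)"
    using F G(1,2) unfolding mixed_edge_cover_partition_def by simp
  ultimately show ?thesis unfolding mixed_edge_cover_partition_def by blast
qed

lemma balanced_cover_partition:
  assumes "\<exists>F. mixed_edge_cover_partition D E ends k F"
  shows "\<exists>F. mixed_edge_cover_partition D E ends k F \<and>
    (\<forall>i\<in>{1..k}. \<forall>j\<in>{1..k}.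
       \<bar>int (card (F i)) - int (card (F j))\<bar> \<le> 1 \<and>
       \<bar>int (card (F i \<inter> E)) - int (card (F j \<inter> E))\<bar> \<le> 2 \<and>
       \<bar>int (card (F i \<inter> arcs D)) - int (card (F j \<inter> arcs D))\<bar> \<le> 2)"
proof -
  define \<Phi> where "\<Phi> F = (\<Sum>i\<in>{1..k}. cover_weight (F i))" for F :: "nat \<Rightarrow> 'e set"
  \<comment> \<open>A minimiser exists because weights are natural numbers; there may be infinitely
    many functions \<open>F\<close>, whose values outside \<open>{1..k}\<close> are
    arbitrary.\<close>
  obtain F where F: "mixed_edge_cover_partition D E ends k F"
    and min: "\<And>G. mixed_edge_cover_partition D E ends k G \<Longrightarrow> \<Phi> F \<le> \<Phi> G"
    using assms ex_has_least_nat[of "mixed_edge_cover_partition D E ends k" _ \<Phi>] by blast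
  have "\<bar>int (card (F i)) - int (card (F j))\<bar> \<le> 1 \<and>
       \<bar>int (card (F i \<inter> E)) - int (card (F j \<inter> E))\<bar> \<le> 2 \<and>
       \<bar>int (card (F i \<inter> arcs D)) - int (card (F j \<inter> arcs D))\<bar> \<le> 2" (is ?balanced)
    if ij: "i \<in> {1..k}" "j \<in> {1..k}" for i j
  proof (rule ccontr)
    assume bad: "\<not> ?balanced"
    then have ne: "i \<noteq> j" by auto
    have cov: "mixed_edge_cover D E ends (F i)" "mixed_edge_cover D E ends (F j)"
      and dij: "F i \<inter> F j = {}"
      using F ij ne unfolding mixed_edge_cover_partition_def disjoint_family_on_def by simp_all
    from rebalance_two_covers[OF cov dij]
    obtain A B where AB: "mixed_edge_cover D E ends A" "mixed_edge_cover D E ends B"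
      "A \<inter> B = {}" "A \<union> B = F i \<union> F j"
      and bal: "\<bar>int (card A) - int (card B)\<bar> \<le> 1" "\<bar>int (card (A \<inter> E)) - int (card (B \<inter> E))\<bar> \<le> 2"
        "\<bar>int (card (A \<inter> arcs D)) - int (card (B \<inter> arcs D))\<bar> \<le> 2"
      by (elim exE conjE) (rule that)
    have "\<Phi> F \<le> \<Phi> (F(i := A, j := B))" by (rule min[OF cover_partition_update[OF F ij ne AB]])
    moreover have "\<Phi> H = cover_weight (H i) + (cover_weight (H j) +
        (\<Sum>l\<in>{1..k} - {i} - {j}. cover_weight (H l)))" for H
    proof -
      have "\<Phi> H = cover_weight (H i) + (\<Sum>l\<in>{1..k} - {i}. cover_weight (H l))"
        unfolding \<Phi>_def by (rule sum.remove) (use ij in auto)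
      also have "(\<Sum>l\<in>{1..k} - {i}. cover_weight (H l)) = cover_weight (H j) +
          (\<Sum>l\<in>{1..k} - {i} - {j}. cover_weight (H l))"
        by (rule sum.remove) (use ij ne in auto)
      finally show ?thesis .
    qed
    moreover have "(\<Sum>l\<in>{1..k} - {i} - {j}. cover_weight ((F(i := A, j := B)) l)) =
        (\<Sum>l\<in>{1..k} - {i} - {j}. cover_weight (F l))"
      by (rule sum.cong) auto
    ultimately have "cover_weight (F i) + cover_weight (F j) \<le> cover_weight A + cover_weight B"
      using ne by simp
    with cover_weight_decrease[OF cov dij AB bal bad] show False by simp
  qed
  with F show ?thesis by blast
qed

end

theorem theorem3:
  fixes D :: "('v, 'e) pre_digraph" and E :: "'e set" and ends :: "'e \<Rightarrow> 'v set" and k :: nat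
  assumes "mixed_graph D E ends"
    and "k \<ge> 1"
    and "\<exists>F. mixed_edge_cover_partition D E ends k F"
  shows "\<exists>F. mixed_edge_cover_partition D E ends k F \<and>
    (\<forall>i\<in>{1..k}. \<forall>j\<in>{1..k}.
       \<bar>int (card (F i)) - int (card (F j))\<bar> \<le> 1 \<and>
       \<bar>int (card (F i \<inter> E)) - int (card (F j \<inter> E))\<bar> \<le> 2 \<and>
       \<bar>int (card (F i \<inter> arcs D)) - int (card (F j \<inter> arcs D))\<bar> \<le> 2)"
  using mixed_graph.balanced_cover_partition[OF assms(1,3)] .

end
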